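(* Let $n,d\ge1$ and let $v_1,\dots,v_n\in\mathbb{S}^{d-1}$ be unit vectors in $\mathbb{R}^d$. Then there exists a unit vector $u\in\mathbb{S}^{d-1}$ with $\langle v_j,u\rangle\neq0$ for all $j$ such that $$\sum_{j=1}^n\frac{1}{\langle v_j,u\rangle^2}\le n^2.$$
   Context: $\langle\cdot,\cdot\rangle$ is the standard inner product on $\mathbb{R}^d$ and $\mathbb{S}^{d-1}$ is the unit sphere of $\mathbb{R}^d$. The vectors $v_j$ are arbitrary unit vectors (repetitions and parallel vectors allowed). *)

theory Defs
  imports "HOL-Analysis.Analysis"
begin

end

theory Submission
  imports Defs "Jordan_Normal_Form.Determinant"
begin


text \<open>Let \<open>G\<close> be the Gram matrix of the given vectors, and suppose first that it is positive definite.
A vector \<open>y\<close> of coefficients with \<open>y\<^sub>i (G y)\<^sub>i = 1\<close> for all \<open>i\<close> yields \<open>u = \<Sum> y\<^sub>j v\<^sub>j\<close> with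
\<open>\<langle>v\<^sub>i, u\<rangle> = 1 / y\<^sub>i\<close> and \<open>\<bar>u\<bar>\<^sup>2 = n\<close>, so after normalizing \<open>u\<close> the claim becomes \<open>\<bar>y\<bar>\<^sup>2 \<le> n\<close>. Such
solutions exist with every pattern of signs (\<open>exists_solution_with_signs\<close>): they are the
critical points of \<open>\<Prod> \<bar>y\<^sub>i\<bar> exp (- y\<^sup>T G y / 2)\<close>. The point is that \<open>\<bar>y\<bar>\<^sup>2\<close> has average exactly
\<open>n\<close> over these \<open>2\<^sup>n\<close> solutions, for suitable positive weights; hence some solution is short
(\<open>exists_short_solution\<close>).

The weights come from interpolation. For a solution \<open>a\<close> the polynomial
\<open>P\<^sub>a(x) = det (diag (1/a) + diag (x) G)\<close> is affine in each \<open>x\<^sub>i\<close>, and it vanishes at every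
other solution \<open>b\<close>, because there \<open>b - a\<close> lies in the kernel of the matrix. So the \<open>2\<^sup>n\<close> polynomials
\<open>P\<^sub>a / P\<^sub>a(a)\<close> form the Lagrange basis of the space of multiaffine polynomials for the
\<open>2\<^sup>n\<close> nodes. Since this space also has dimension \<open>2\<^sup>n\<close>, the square matrix of coefficients
of this basis and the matrix of values of the monomials at the nodes are inverse to each other
on both sides (\<open>biorthogonal_swap\<close>). Reading off the column of constant coefficients
\<open>w\<^sub>a = P\<^sub>a(0) / P\<^sub>a(a)\<close>, which are positive, gives \<open>\<Sum> w\<^sub>a = 1\<close> and \<open>\<Sum> w\<^sub>a a\<^sub>i a\<^sub>j = 0\<close> for
\<open>i \<noteq> j\<close>. As \<open>G\<^sub>i\<^sub>i = 1\<close>, the equation of index \<open>i\<close> says \<open>a\<^sub>i\<^sup>2 = 1 - \<Sum>\<^sub>j\<^sub>\<noteq>\<^sub>i G\<^sub>i\<^sub>j a\<^sub>i a\<^sub>j\<close>, so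
\<open>\<Sum> w\<^sub>a a\<^sub>i\<^sup>2 = 1\<close>, and summing over \<open>i\<close> gives the average \<open>n\<close>.

For linearly dependent vectors, \<open>G\<close> is replaced by \<open>(G + \<epsilon> I) / (1 + \<epsilon>)\<close>, and a limit point of the
resulting vectors \<open>u\<close> as \<open>\<epsilon> \<rightarrow> 0\<close> still works.\<close>

no_notation scalar_prod (infix "\<bullet>" 70)

section \<open>The interpolating determinants\<close>

definition pairing_solution :: "nat \<Rightarrow> (nat \<Rightarrow> nat \<Rightarrow> real) \<Rightarrow> (nat \<Rightarrow> real) \<Rightarrow> bool" where
  "pairing_solution n G y \<longleftrightarrow> (\<forall>i<n. y i * (\<Sum>j<n. G i j * y j) = 1)"

text \<open>The polynomial \<open>P\<^sub>a\<close> attached to the node \<open>a\<close>. It is the Bezoutian determinant of the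
quadratic system \<open>y\<^sub>i (G y)\<^sub>i = 1\<close>, whose second argument has been fixed to the root \<open>a\<close>.\<close>
definition interp :: "nat \<Rightarrow> (nat \<Rightarrow> nat \<Rightarrow> real) \<Rightarrow> (nat \<Rightarrow> real) \<Rightarrow> (nat \<Rightarrow> real) \<Rightarrow> real" where
  "interp n G a x = det (mat n n (\<lambda>(i, j). (if i = j then 1 / a i else 0) + x i * G i j))"

lemma det_mat_eq_0_iff:
  fixes A :: "nat \<Rightarrow> nat \<Rightarrow> real"
  shows "det (mat n n (\<lambda>(i, j). A i j)) = 0 \<longleftrightarrow>
    (\<exists>z. (\<exists>i<n. z i \<noteq> 0) \<and> (\<forall>i<n. (\<Sum>j<n. A i j * z j) = 0))"
proof -
  let ?M = "mat n n (\<lambda>(i, j). A i j)"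
  have M: "?M \<in> carrier_mat n n" by simp
  have row: "(?M *\<^sub>v v) $ i = (\<Sum>j<n. A i j * v $ j)" if "i < n" "v \<in> carrier_vec n" for v i
    using that by (simp add: scalar_prod_def atLeast0LessThan)
  show ?thesis unfolding det_0_iff_vec_prod_zero_field[OF M]
  proof
    assume "\<exists>v. v \<in> carrier_vec n \<and> v \<noteq> 0\<^sub>v n \<and> ?M *\<^sub>v v = 0\<^sub>v n"
    then obtain v where v: "v \<in> carrier_vec n" "v \<noteq> 0\<^sub>v n" "?M *\<^sub>v v = 0\<^sub>v n" by blast
    have "\<exists>i<n. v $ i \<noteq> 0"
    proof (rule ccontr)
      assume "\<not> ?thesis"
      then have "v = 0\<^sub>v n" using v(1) by (intro eq_vecI) auto
      with v(2) show False by simp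
    qed
    moreover have "\<forall>i<n. (\<Sum>j<n. A i j * v $ j) = 0"
      using row v by (metis index_zero_vec(1))
    ultimately show "\<exists>z. (\<exists>i<n. z i \<noteq> 0) \<and> (\<forall>i<n. (\<Sum>j<n. A i j * z j) = 0)" by blast
  next
    assume "\<exists>z. (\<exists>i<n. z i \<noteq> 0) \<and> (\<forall>i<n. (\<Sum>j<n. A i j * z j) = 0)"
    then obtain z where z: "\<exists>i<n. z i \<noteq> 0" "\<forall>i<n. (\<Sum>j<n. A i j * z j) = 0" by blast
    let ?v = "Matrix.vec n z"
    have "?v \<noteq> 0\<^sub>v n" using z(1) by (metis index_vec index_zero_vec(1))
    moreover have "?M *\<^sub>v ?v = 0\<^sub>v n"
      using z(2) by (intro eq_vecI) (auto simp: scalar_prod_def atLeast0LessThan)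
    ultimately show "\<exists>v. v \<in> carrier_vec n \<and> v \<noteq> 0\<^sub>v n \<and> ?M *\<^sub>v v = 0\<^sub>v n"
      by (intro exI[of _ ?v]) auto
  qed
qed

lemma interp_eq_0_iff:
  "interp n G a x = 0 \<longleftrightarrow>
    (\<exists>z. (\<exists>i<n. z i \<noteq> 0) \<and> (\<forall>i<n. z i / a i + x i * (\<Sum>j<n. G i j * z j) = 0))"
proof -
  have "(\<Sum>j<n. ((if i = j then 1 / a i else 0) + x i * G i j) * z j)
      = z i / a i + x i * (\<Sum>j<n. G i j * z j)" if "i < n" for z i
  proof -
    have "(\<Sum>j<n. ((if i = j then 1 / a i else 0) + x i * G i j) * z j)
      = (\<Sum>j<n. (if i = j then z j / a i else 0) + x i * (G i j * z j))"
      by (intro sum.cong) (auto simp: algebra_simps)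
    then show ?thesis using that by (simp add: sum.distrib sum_distrib_left)
  qed
  then show ?thesis unfolding interp_def det_mat_eq_0_iff by simp
qed

text \<open>Subtracting the equations of two solutions factors their difference through \<open>b - a\<close>:
\<open>0 = b\<^sub>i (G b)\<^sub>i - a\<^sub>i (G a)\<^sub>i = (b\<^sub>i - a\<^sub>i) (G a)\<^sub>i + b\<^sub>i (G (b - a))\<^sub>i\<close>, where
\<open>(G a)\<^sub>i = 1 / a\<^sub>i\<close>. So \<open>b - a\<close> is a nonzero kernel vector.\<close>

lemma interp_vanishes:
  assumes a: "pairing_solution n G a" and b: "pairing_solution n G b"
    and ne: "\<exists>i<n. a i \<noteq> b i"
  shows "interp n G a b = 0"
  unfolding interp_eq_0_iff
proof (intro exI[of _ "\<lambda>i. b i - a i"] conjI allI impI)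
  show "\<exists>i<n. b i - a i \<noteq> 0" using ne by auto
  fix i assume i: "i < n"
  have A: "a i * (\<Sum>j<n. G i j * a j) = 1" and B: "b i * (\<Sum>j<n. G i j * b j) = 1"
    using a b i unfolding pairing_solution_def by auto
  have nz: "a i \<noteq> 0" using A by auto
  have A': "(\<Sum>j<n. G i j * a j) = 1 / a i" using A nz by (simp add: field_simps)
  have "b i * (\<Sum>j<n. G i j * (b j - a j)) = 1 - b i / a i"
    using B by (simp add: right_diff_distrib sum_subtractf A')
  moreover have "(b i - a i) / a i = b i / a i - 1" using nz by (simp add: diff_divide_distrib)
  ultimately show "(b i - a i) / a i + b i * (\<Sum>j<n. G i j * (b j - a j)) = 0" by simp
qed

text \<open>The variable \<open>x\<^sub>i\<close> occurs in row \<open>i\<close> only, and there to the first power.\<close>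

lemma interp_multiaffine:
  "\<exists>c. \<forall>x. interp n G a x = (\<Sum>S\<in>Pow {..<n}. c S * (\<Prod>i\<in>S. x i))"
proof -
  define c where "c S = (\<Sum>p | p permutes {..<n}. signof p *
      ((\<Prod>i\<in>S. G i (p i)) * (\<Prod>i\<in>{..<n} - S. if i = p i then 1 / a i else 0)))" for S
  have "interp n G a x = (\<Sum>S\<in>Pow {..<n}. c S * (\<Prod>i\<in>S. x i))" for x
  proof -
    have "p i < n" if "p permutes {..<n}" "i < n" for p i
      using permutes_in_image[OF that(1), of i] that(2) by simp
    then have entry: "mat n n (\<lambda>(i, j). (if i = j then 1 / a i else 0) + x i * G i j) $$ (i, p i)
        = x i * G i (p i) + (if i = p i then 1 / a i else 0)"
      if "p permutes {..<n}" "i < n" for p i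
      using that by simp
    have "interp n G a x = (\<Sum>p | p permutes {..<n}. signof p *
        (\<Prod>i<n. mat n n (\<lambda>(i, j). (if i = j then 1 / a i else 0) + x i * G i j) $$ (i, p i)))"
      unfolding interp_def by (simp only: det_def'[OF mat_carrier] atLeast0LessThan)
    also have "\<dots> = (\<Sum>p | p permutes {..<n}. signof p *
        (\<Prod>i<n. x i * G i (p i) + (if i = p i then 1 / a i else 0)))"
    proof (rule sum.cong[OF refl], rule arg_cong[where f = "(*) (signof _)"], rule prod.cong[OF refl])
      fix p i assume "p \<in> {p. p permutes {..<n}}" "i \<in> {..<n}"
      then show "mat n n (\<lambda>(i, j). (if i = j then 1 / a i else 0) + x i * G i j) $$ (i, p i)
        = x i * G i (p i) + (if i = p i then 1 / a i else 0)"
        using entry by simp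
    qed
    also have "\<dots> = (\<Sum>p | p permutes {..<n}. \<Sum>S\<in>Pow {..<n}. signof p *
        ((\<Prod>i\<in>S. x i * G i (p i)) * (\<Prod>i\<in>{..<n} - S. if i = p i then 1 / a i else 0)))"
      by (simp only: prod_add[OF finite_lessThan] sum_distrib_left)
    also have "\<dots> = (\<Sum>p | p permutes {..<n}. \<Sum>S\<in>Pow {..<n}. signof p *
        ((\<Prod>i\<in>S. G i (p i)) * (\<Prod>i\<in>{..<n} - S. if i = p i then 1 / a i else 0)) * (\<Prod>i\<in>S. x i))"
      by (intro sum.cong refl) (simp only: prod.distrib ac_simps)
    also have "\<dots> = (\<Sum>S\<in>Pow {..<n}. \<Sum>p | p permutes {..<n}. signof p *
        ((\<Prod>i\<in>S. G i (p i)) * (\<Prod>i\<in>{..<n} - S. if i = p i then 1 / a i else 0)) * (\<Prod>i\<in>S. x i))"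
      by (rule sum.swap)
    also have "\<dots> = (\<Sum>S\<in>Pow {..<n}. c S * (\<Prod>i\<in>S. x i))"
      by (simp only: c_def sum_distrib_right)
    finally show ?thesis .
  qed
  then show ?thesis by blast
qed

text \<open>Along the segment from \<open>0\<close> to \<open>a\<close> the determinant never vanishes: a kernel vector \<open>z\<close> at
\<open>t a\<close> would satisfy \<open>\<Sum> (z\<^sub>i / a\<^sub>i)\<^sup>2 + t z\<^sup>T G z = 0\<close>. So its sign is constant there. This makes the
weights \<open>w\<^sub>a\<close> positive.\<close>

lemma interp_at_0_same_sign:
  assumes psd: "\<And>z. 0 \<le> (\<Sum>i<n. z i * (\<Sum>j<n. G i j * z j))"
    and a: "\<And>i. i < n \<Longrightarrow> a i \<noteq> 0"
  shows "interp n G a (\<lambda>_. 0) / interp n G a a > 0"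
proof -
  define h where "h t = interp n G a (\<lambda>i. t * a i)" for t
  have nz: "h t \<noteq> 0" if t: "0 \<le> t" for t
  proof
    assume "h t = 0"
    then obtain z where z: "\<exists>i<n. z i \<noteq> 0"
      and eq: "\<And>i. i < n \<Longrightarrow> z i / a i + t * a i * (\<Sum>j<n. G i j * z j) = 0"
      unfolding h_def interp_eq_0_iff by blast
    have "(z i / a i)\<^sup>2 + t * (z i * (\<Sum>j<n. G i j * z j)) = 0" if "i < n" for i
      using arg_cong[OF eq[OF that], of "\<lambda>r. r * (z i / a i)"] a[OF that]
      by (simp add: field_simps power2_eq_square)
    then have "(\<Sum>i<n. (z i / a i)\<^sup>2 + t * (z i * (\<Sum>j<n. G i j * z j))) = 0"
      by (intro sum.neutral) auto
    then have "(\<Sum>i<n. (z i / a i)\<^sup>2) + t * (\<Sum>i<n. z i * (\<Sum>j<n. G i j * z j)) = 0"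
      by (simp add: sum.distrib sum_distrib_left)
    moreover have "0 \<le> t * (\<Sum>i<n. z i * (\<Sum>j<n. G i j * z j))"
      using psd t by simp
    moreover have "0 \<le> (\<Sum>i<n. (z i / a i)\<^sup>2)" by (intro sum_nonneg) auto
    ultimately have "(\<Sum>i<n. (z i / a i)\<^sup>2) = 0" by linarith
    then have "\<forall>i<n. (z i / a i)\<^sup>2 = 0" by (subst (asm) sum_nonneg_eq_0_iff) auto
    with a have "\<forall>i<n. z i = 0" by auto
    with z show False by auto
  qed
  obtain c where c: "\<And>x. interp n G a x = (\<Sum>S\<in>Pow {..<n}. c S * (\<Prod>i\<in>S. x i))"
    using interp_multiaffine[of n G a] by blast
  have cont: "continuous_on {0..1} h"
    unfolding h_def c by (intro continuous_intros)
  have "h 0 * h 1 > 0"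
  proof (rule ccontr)
    assume "\<not> ?thesis"
    then have "h 0 \<le> 0 \<and> 0 \<le> h 1 \<or> h 1 \<le> 0 \<and> 0 \<le> h 0"
      by (auto simp: not_less mult_le_0_iff)
    then obtain t where "0 \<le> t" "t \<le> 1" "h t = 0"
      using IVT'[of h 0 0 1] IVT2'[of h 1 0 0] cont by fastforce
    with nz show False by blast
  qed
  then show ?thesis by (simp add: h_def zero_less_mult_iff zero_less_divide_iff)
qed

section \<open>Interchanging nodes and monomials\<close>

text \<open>For square matrices \<open>C B = 1\<close> implies \<open>B C = 1\<close>; the index sets are merely enumerated to apply
this.\<close>

lemma biorthogonal_swap:
  fixes b c :: "'a \<Rightarrow> 'b \<Rightarrow> real"
  assumes fin: "finite X" "finite Y" and card: "card X = card Y"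
    and dual: "\<And>x x'. x \<in> X \<Longrightarrow> x' \<in> X \<Longrightarrow>
      (\<Sum>s\<in>Y. c x s * b x' s) = (if x = x' then 1 else 0)"
    and st: "s \<in> Y" "t \<in> Y"
  shows "(\<Sum>x\<in>X. b x s * c x t) = (if s = t then 1 else 0)"
proof -
  define N where "N = card X"
  obtain f where f: "bij_betw f {0..<N} X"
    using ex_bij_betw_nat_finite[OF fin(1)] unfolding N_def by blast
  obtain g where g: "bij_betw g {0..<N} Y"
    using ex_bij_betw_nat_finite[OF fin(2)] card unfolding N_def by auto
  define C where "C = mat N N (\<lambda>(i, j). c (f i) (g j))"
  define B where "B = mat N N (\<lambda>(i, j). b (f j) (g i))"
  have carr: "C \<in> carrier_mat N N" "B \<in> carrier_mat N N" unfolding C_def B_def by auto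
  have fX: "f i \<in> X" if "i < N" for i using f that by (auto simp: bij_betw_def)
  have finj: "f i = f j \<longleftrightarrow> i = j" if "i < N" "j < N" for i j
    using f that by (auto simp: bij_betw_def inj_on_def)
  have "C * B = 1\<^sub>m N"
  proof (rule eq_matI)
    fix i j assume "i < dim_row (1\<^sub>m N :: real mat)" "j < dim_col (1\<^sub>m N :: real mat)"
    then have ij: "i < N" "j < N" by auto
    have "(C * B) $$ (i, j) = (\<Sum>k = 0..<N. c (f i) (g k) * b (f j) (g k))"
      using ij by (simp add: C_def B_def scalar_prod_def)
    also have "\<dots> = (\<Sum>s\<in>Y. c (f i) s * b (f j) s)"
      by (rule sum.reindex_bij_betw[OF g])
    also have "\<dots> = (if i = j then 1 else 0)"
      using dual fX finj ij by auto
    finally show "(C * B) $$ (i, j) = 1\<^sub>m N $$ (i, j)" using ij by simp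
  qed (auto simp: C_def B_def)
  then have BC: "B * C = 1\<^sub>m N" using mat_mult_left_right_inverse[OF carr] by simp
  obtain i j where ij: "i < N" "g i = s" "j < N" "g j = t"
    using g st unfolding bij_betw_def by (metis atLeastLessThan_iff imageE)
  have "(\<Sum>x\<in>X. b x s * c x t) = (\<Sum>k = 0..<N. b (f k) s * c (f k) t)"
    by (rule sum.reindex_bij_betw[OF f, symmetric])
  also have "\<dots> = (B * C) $$ (i, j)"
    using ij by (simp add: C_def B_def scalar_prod_def)
  also have "\<dots> = (if s = t then 1 else 0)"
    unfolding BC using ij g by (auto simp: bij_betw_def inj_on_def)
  finally show ?thesis .
qed

section \<open>One solution in each orthant\<close>

text \<open>The function \<open>F z = \<Prod> z\<^sub>i exp (- z\<^sup>T G z / 2)\<close> has a maximum \<open>y\<close> on the cube \<open>[0, R]\<^sup>n\<close>. The derivative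
of \<open>F\<close> in direction \<open>k\<close> has the sign of \<open>1 - y\<^sub>k (G y)\<^sub>k\<close>. As \<open>y\<^sub>k > 0\<close>, it is possible to move
inwards, so \<open>y\<^sub>k (G y)\<^sub>k \<le> 1\<close> even on the outer faces. Summing gives \<open>y\<^sup>T G y \<le> n\<close>, which for large
\<open>R\<close> keeps \<open>y\<close> away from the outer faces, and then the derivatives vanish.\<close>

lemma exists_positive_solution:
  assumes sym: "\<And>i j. i < n \<Longrightarrow> j < n \<Longrightarrow> G i j = G j i"
    and c: "c > 0"
    and pd: "\<And>z. c * (\<Sum>i<n. (z i)\<^sup>2) \<le> (\<Sum>i<n. z i * (\<Sum>j<n. G i j * z j))"
  shows "\<exists>y. (\<forall>i<n. y i > 0) \<and> pairing_solution n G y"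
proof -
  define Q :: "(nat \<Rightarrow> real) \<Rightarrow> real" where "Q z = (\<Sum>i<n. z i * (\<Sum>j<n. G i j * z j))" for z
  define F where "F z = (\<Prod>i<n. z i) * exp (- Q z / 2)" for z
  (* any R with R \<ge> 1 and c R^2 > n serves: the cube contains (1, ..., 1), where F > 0,
     and its outer faces lie outside the ellipsoid given by the quadratic form at level n *)
  define R where "R = 1 + real n / c"
  define K :: "(nat \<Rightarrow> real) set" where "K = PiE UNIV (\<lambda>_. {0..R})"
  have R1: "1 \<le> R" using c by (simp add: R_def)
  have R2: "real n < c * R\<^sup>2"
  proof -
    have "real n < c * R" using c by (simp add: R_def field_simps)
    also have "\<dots> \<le> c * R\<^sup>2" using c R1 by (simp add: power2_eq_square)
    finally show ?thesis .
  qed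
  have "compact K"
    using compactin_PiE[of "\<lambda>_. euclidean" UNIV "\<lambda>_::nat. {0..R}"]
    unfolding K_def euclidean_product_topology by simp
  moreover have "K \<noteq> {}" using R1 by (auto simp: K_def PiE_eq_empty_iff)
  moreover have "continuous_on K F"
    unfolding F_def Q_def
    by (intro continuous_intros continuous_on_product_then_coordinatewise) auto
  ultimately obtain y where y: "y \<in> K" and max: "\<And>z. z \<in> K \<Longrightarrow> F z \<le> F y"
    using continuous_attains_sup by metis
  have yK: "0 \<le> y i" "y i \<le> R" for i using y by (auto simp: K_def PiE_iff)
  have "0 < F (\<lambda>_. 1)" by (simp add: F_def)
  also have "\<dots> \<le> F y" using R1 by (intro max) (auto simp: K_def)
  finally have Fy: "0 < F y" .
  then have "(\<Prod>i<n. y i) \<noteq> 0" by (metis F_def mult_zero_left order_less_irrefl)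
  then have ypos: "0 < y i" if "i < n" for i
    using that yK(1)[of i] by (auto simp: less_le)
  define g where "g k = (\<Sum>j<n. G k j * y j)" for k
  define \<phi> where "\<phi> k s = F (y(k := y k + s))" for k s
  have deriv: "(\<phi> k has_real_derivative (\<Prod>i\<in>{..<n} - {k}. y i) * exp (- Q y / 2) * (1 - y k * g k)) (at 0)"
    if k: "k < n" for k
  proof -
    have "Q (y(k := y k + s)) = Q y + 2 * s * g k + s\<^sup>2 * G k k" for s
    proof -
      define e where "e i = (if i = k then s else 0)" for i
      have upd: "y(k := y k + s) = (\<lambda>i. y i + e i)" by (auto simp: e_def)
      have e: "(\<Sum>i<n. f i * e i) = f k * s" for f :: "nat \<Rightarrow> real"
        using k by (simp add: e_def if_distrib[of "\<lambda>r. f _ * r"] cong: if_cong)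
      have inner: "(\<Sum>j<n. G i j * (y j + e j)) = g i + G i k * s" for i
        by (simp add: distrib_left sum.distrib e g_def)
      have "Q (y(k := y k + s)) = (\<Sum>i<n. (y i + e i) * (g i + G i k * s))"
        by (simp add: upd Q_def inner)
      also have "\<dots> = (\<Sum>i<n. y i * g i) + s * (\<Sum>i<n. G i k * y i)
          + (\<Sum>i<n. (g i + G i k * s) * e i)"
        by (simp add: algebra_simps sum.distrib sum_distrib_left)
      also have "(\<Sum>i<n. G i k * y i) = g k"
        unfolding g_def using k by (intro sum.cong) (auto simp: sym)
      also have "(\<Sum>i<n. (g i + G i k * s) * e i) = (g k + G k k * s) * s" by (rule e)
      also have "(\<Sum>i<n. y i * g i) = Q y" by (simp add: Q_def g_def)
      finally show ?thesis by (simp add: fun_upd_def algebra_simps power2_eq_square)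
    qed
    moreover have "(\<Prod>i<n. (y(k := y k + s)) i) = (y k + s) * (\<Prod>i\<in>{..<n} - {k}. y i)" for s
      using k by (subst prod.remove[of _ k]) (auto intro!: prod.cong)
    ultimately have \<phi>: "\<phi> k = (\<lambda>s. (y k + s) * (\<Prod>i\<in>{..<n} - {k}. y i)
        * exp (- (Q y + 2 * s * g k + s\<^sup>2 * G k k) / 2))"
      by (auto simp: \<phi>_def F_def)
    show ?thesis unfolding \<phi>
      by (rule derivative_eq_intros refl | simp add: algebra_simps)+
  qed
  have coeff: "0 < (\<Prod>i\<in>{..<n} - {k}. y i) * exp (- Q y / 2)" for k
    using ypos by (intro mult_pos_pos prod_pos) auto
  have upper: "y k * g k \<le> 1" if k: "k < n" for k
  proof (rule ccontr)
    assume "\<not> ?thesis"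
    then have "(\<Prod>i\<in>{..<n} - {k}. y i) * exp (- Q y / 2) * (1 - y k * g k) < 0"
      using coeff[of k] by (intro mult_pos_neg) auto
    from DERIV_neg_dec_left[OF deriv[OF k] this] obtain d where
      d: "d > 0" "\<And>h. 0 < h \<Longrightarrow> h < d \<Longrightarrow> \<phi> k 0 < \<phi> k (0 - h)" by auto
    define h where "h = min (d / 2) (y k)"
    have h: "0 < h" "h < d" "h \<le> y k" using d(1) ypos[OF k] by (auto simp: h_def)
    have "y k - h \<le> R" using h yK(2)[of k] by linarith
    then have "y(k := y k + (0 - h)) \<in> K" using h yK by (auto simp: K_def PiE_iff)
    with max d(2)[OF h(1,2)] show False by (fastforce simp: \<phi>_def)
  qed
  have "Q y \<le> n"
  proof -
    have "Q y = (\<Sum>k<n. y k * g k)" by (simp add: Q_def g_def)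
    also have "\<dots> \<le> (\<Sum>k<n. 1)" by (intro sum_mono upper) auto
    finally show ?thesis by simp
  qed
  have interior: "y k < R" if k: "k < n" for k
  proof -
    have "c * (y k)\<^sup>2 \<le> c * (\<Sum>i<n. (y i)\<^sup>2)"
      using k c by (intro mult_left_mono member_le_sum) auto
    also have "\<dots> \<le> Q y" using pd by (simp add: Q_def)
    finally have "c * (y k)\<^sup>2 < c * R\<^sup>2" using \<open>Q y \<le> n\<close> R2 by linarith
    then have "(y k)\<^sup>2 < R\<^sup>2" using c by simp
    then show ?thesis by (rule power2_less_imp_less) (use R1 in simp)
  qed
  have "y k * g k = 1" if k: "k < n" for k
  proof (rule ccontr)
    assume "\<not> ?thesis"
    with upper[OF k] have "0 < (\<Prod>i\<in>{..<n} - {k}. y i) * exp (- Q y / 2) * (1 - y k * g k)"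
      using coeff[of k] by (intro mult_pos_pos[of "_ * _"]) auto
    from DERIV_pos_inc_right[OF deriv[OF k] this] obtain d where
      d: "d > 0" "\<And>h. 0 < h \<Longrightarrow> h < d \<Longrightarrow> \<phi> k 0 < \<phi> k (0 + h)" by auto
    define h where "h = min (d / 2) (R - y k)"
    have h: "0 < h" "h < d" "y k + h \<le> R" using d(1) interior[OF k] by (auto simp: h_def)
    have "y(k := y k + (0 + h)) \<in> K" using h yK ypos[OF k] by (auto simp: K_def PiE_iff)
    with max d(2)[OF h(1,2)] show False by (fastforce simp: \<phi>_def)
  qed
  with ypos show ?thesis by (auto simp: pairing_solution_def g_def)
qed

text \<open>Conjugating \<open>G\<close> by the diagonal matrix of the signs moves any orthant to the positive one.\<close>

lemma exists_solution_with_signs: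
  assumes sym: "\<And>i j. i < n \<Longrightarrow> j < n \<Longrightarrow> G i j = G j i"
    and c: "c > 0"
    and pd: "\<And>z. c * (\<Sum>i<n. (z i)\<^sup>2) \<le> (\<Sum>i<n. z i * (\<Sum>j<n. G i j * z j))"
  shows "\<exists>y. (\<forall>i<n. y i < 0 \<longleftrightarrow> i \<in> E) \<and> pairing_solution n G y"
proof -
  define s :: "nat \<Rightarrow> real" where "s i = (if i \<in> E then -1 else 1)" for i
  have s2: "(s i)\<^sup>2 = 1" for i by (simp add: s_def)
  have "\<exists>x. (\<forall>i<n. x i > 0) \<and> pairing_solution n (\<lambda>i j. s i * s j * G i j) x"
  proof (rule exists_positive_solution[OF _ c])
    show "s i * s j * G i j = s j * s i * G j i" if "i < n" "j < n" for i j
      using sym[OF that] by simp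
    show "c * (\<Sum>i<n. (z i)\<^sup>2) \<le> (\<Sum>i<n. z i * (\<Sum>j<n. s i * s j * G i j * z j))" for z
    proof -
      have "(\<Sum>i<n. z i * (\<Sum>j<n. s i * s j * G i j * z j))
          = (\<Sum>i<n. s i * z i * (\<Sum>j<n. G i j * (s j * z j)))"
        unfolding sum_distrib_left by (intro sum.cong refl) (simp only: ac_simps)
      then show ?thesis using pd[of "\<lambda>i. s i * z i"] by (simp add: power_mult_distrib s2)
    qed
  qed
  then obtain x where x: "\<And>i. i < n \<Longrightarrow> x i > 0"
    and sol: "\<And>i. i < n \<Longrightarrow> x i * (\<Sum>j<n. s i * s j * G i j * x j) = 1"
    unfolding pairing_solution_def by blast
  have "pairing_solution n G (\<lambda>i. s i * x i)"
    unfolding pairing_solution_def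
  proof (intro allI impI)
    fix i assume "i < n"
    have "s i * x i * (\<Sum>j<n. G i j * (s j * x j)) = x i * (\<Sum>j<n. s i * s j * G i j * x j)"
      unfolding sum_distrib_left by (intro sum.cong refl) (simp only: ac_simps)
    with sol[OF \<open>i < n\<close>] show "s i * x i * (\<Sum>j<n. G i j * (s j * x j)) = 1" by simp
  qed
  moreover have "\<forall>i<n. s i * x i < 0 \<longleftrightarrow> i \<in> E"
    using x by (force simp: s_def not_less less_imp_le)
  ultimately show ?thesis by (intro exI[of _ "\<lambda>i. s i * x i"]) auto
qed
section \<open>The weighted average over all orthants\<close>

text \<open>The nodes are indexed by the sets \<open>E\<close> of their negative coordinates, and the monomials by their
sets of variables; both range over all subsets of the index set, so there are equally many.\<close>

lemma exists_short_solution: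
  assumes sym: "\<And>i j. i < n \<Longrightarrow> j < n \<Longrightarrow> G i j = G j i"
    and diag: "\<And>i. i < n \<Longrightarrow> G i i = 1"
    and c: "c > 0"
    and pd: "\<And>z. c * (\<Sum>i<n. (z i)\<^sup>2) \<le> (\<Sum>i<n. z i * (\<Sum>j<n. G i j * z j))"
  shows "\<exists>y. pairing_solution n G y \<and> (\<Sum>i<n. (y i)\<^sup>2) \<le> n"
proof -
  define X where "X = Pow {..<n}"
  have finX: "finite X" by (simp add: X_def)
  obtain a where a: "\<And>E i. i < n \<Longrightarrow> a E i < 0 \<longleftrightarrow> i \<in> E" "\<And>E. pairing_solution n G (a E)"
    using exists_solution_with_signs[OF sym c pd] by metis
  have anz: "a E i \<noteq> 0" if "i < n" for E i
    using a(2)[of E] that by (auto simp: pairing_solution_def)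
  have psd: "0 \<le> (\<Sum>i<n. z i * (\<Sum>j<n. G i j * z j))" for z
    by (rule order_trans[OF _ pd]) (use c in \<open>simp add: sum_nonneg\<close>)
  have "\<forall>E. \<exists>c. \<forall>x. interp n G (a E) x = (\<Sum>S\<in>X. c S * (\<Prod>i\<in>S. x i))"
    unfolding X_def by (intro allI interp_multiaffine)
  then obtain coef where coef:
    "\<And>E x. interp n G (a E) x = (\<Sum>S\<in>X. coef E S * (\<Prod>i\<in>S. x i))"
    unfolding choice_iff by blast
  define d where "d E = interp n G (a E) (a E)" for E
  define w where "w E = coef E {} / d E" for E
  have "coef E {} = interp n G (a E) (\<lambda>_. 0)" for E
  proof -
    have "interp n G (a E) (\<lambda>_. 0) = (\<Sum>S\<in>X. if S = {} then coef E {} else 0)"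
      unfolding coef by (intro sum.cong) (auto simp: X_def dest: finite_subset)
    then show ?thesis using finX by (simp add: X_def)
  qed
  then have wpos: "0 < w E" for E
    using interp_at_0_same_sign[OF psd anz] by (simp add: w_def d_def)
  have d: "d E \<noteq> 0" for E using wpos[of E] by (auto simp: w_def)
  have swap: "(\<Sum>E\<in>X. (\<Prod>i\<in>S. a E i) * (coef E T / d E)) = (if S = T then 1 else 0)"
    if ST: "S \<in> X" "T \<in> X" for S T
  proof (rule biorthogonal_swap[OF finX finX refl _ ST])
    fix E E' assume E: "E \<in> X" "E' \<in> X"
    have "(\<Sum>S\<in>X. coef E S / d E * (\<Prod>i\<in>S. a E' i)) = interp n G (a E) (a E') / d E"
      unfolding coef sum_divide_distrib by simp
    also have "\<dots> = (if E = E' then 1 else 0)"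
    proof (cases "E = E'")
      case True
      then show ?thesis using d by (simp add: d_def)
    next
      case False
      then obtain i where "i < n" "i \<in> E \<longleftrightarrow> i \<notin> E'" using E by (auto simp: X_def)
      with a(1) have "\<exists>i<n. a E i \<noteq> a E' i" by metis
      then show ?thesis using interp_vanishes a(2) False by simp
    qed
    finally show "(\<Sum>S\<in>X. coef E S / d E * (\<Prod>i\<in>S. a E' i)) = (if E = E' then 1 else 0)" .
  qed
  \<comment> \<open>\<open>T = {}\<close> selects the constant coefficients, whose normalized values are the weights\<close>
  have w1: "(\<Sum>E\<in>X. w E) = 1"
    using swap[of "{}" "{}"] by (simp add: X_def w_def)
  have w_cross: "(\<Sum>E\<in>X. w E * (a E i * a E j)) = 0" if "i < n" "j < n" "i \<noteq> j" for i j
    using swap[of "{i, j}" "{}"] that by (simp add: X_def w_def mult_ac)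
  have w_square: "(\<Sum>E\<in>X. w E * (a E i)\<^sup>2) = 1" if i: "i < n" for i
  proof -
    have "w E * (a E i)\<^sup>2 = w E - (\<Sum>j\<in>{..<n} - {i}. G i j * (w E * (a E i * a E j)))" for E
    proof -
      have "1 = a E i * (\<Sum>j<n. G i j * a E j)"
        using a(2) i by (simp add: pairing_solution_def)
      also have "\<dots> = (a E i)\<^sup>2 + (\<Sum>j\<in>{..<n} - {i}. G i j * (a E i * a E j))"
        using i diag[OF i]
        by (simp add: sum.remove[of _ i] distrib_left power2_eq_square sum_distrib_left mult_ac)
      finally have "w E = w E * ((a E i)\<^sup>2 + (\<Sum>j\<in>{..<n} - {i}. G i j * (a E i * a E j)))"
        by simp
      then show ?thesis by (simp add: distrib_left sum_distrib_left mult_ac)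
    qed
    then have "(\<Sum>E\<in>X. w E * (a E i)\<^sup>2)
        = 1 - (\<Sum>E\<in>X. \<Sum>j\<in>{..<n} - {i}. G i j * (w E * (a E i * a E j)))"
      by (simp add: sum_subtractf w1)
    also have "(\<Sum>E\<in>X. \<Sum>j\<in>{..<n} - {i}. G i j * (w E * (a E i * a E j)))
        = (\<Sum>j\<in>{..<n} - {i}. G i j * (\<Sum>E\<in>X. w E * (a E i * a E j)))"
      by (subst sum.swap) (simp add: sum_distrib_left)
    also have "\<dots> = 0" using w_cross i by (intro sum.neutral) auto
    finally show ?thesis by simp
  qed
  have "(\<Sum>E\<in>X. w E * (\<Sum>i<n. (a E i)\<^sup>2)) = (\<Sum>i<n. \<Sum>E\<in>X. w E * (a E i)\<^sup>2)"
    unfolding sum_distrib_left by (rule sum.swap)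
  then have avg: "(\<Sum>E\<in>X. w E * (\<Sum>i<n. (a E i)\<^sup>2)) = n" by (simp add: w_square)
  have "\<exists>E\<in>X. (\<Sum>i<n. (a E i)\<^sup>2) \<le> n"
  proof (rule ccontr)
    assume "\<not> ?thesis"
    then have "(\<Sum>E\<in>X. w E * n) < (\<Sum>E\<in>X. w E * (\<Sum>i<n. (a E i)\<^sup>2))"
      using wpos finX by (intro sum_strict_mono) (auto simp: X_def not_le)
    then show False by (simp add: avg w1 flip: sum_distrib_right)
  qed
  with a(2) show ?thesis by blast
qed

section \<open>Passing to arbitrary unit vectors\<close>

text \<open>Adding \<open>e\<close> to the diagonal of the Gram matrix makes it positive definite, whatever the vectors are,
and dividing by \<open>1 + e\<close> restores the unit diagonal. The bound on \<open>y\<close> does not depend on \<open>e\<close>, so the terms with a factor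
\<open>e\<close> disappear in the limit \<open>e \<rightarrow> 0\<close>.\<close>

lemma regularized_solution:
  fixes v :: "nat \<Rightarrow> 'a :: real_inner"
  assumes unit: "\<And>i. i < n \<Longrightarrow> norm (v i) = 1" and e: "e > 0"
  shows "\<exists>y u. (norm u)\<^sup>2 + e * (\<Sum>i<n. (y i)\<^sup>2) = (1 + e) * n
    \<and> (\<Sum>i<n. (y i)\<^sup>2) \<le> n \<and> (\<forall>i<n. y i * inner (v i) u = 1 + e - e * (y i)\<^sup>2)"
proof -
  define G where "G i j = (inner (v i) (v j) + (if i = j then e else 0)) / (1 + e)" for i j
  define u where "u z = (\<Sum>j<n. z j *\<^sub>R v j)" for z
  have G: "(\<Sum>j<n. G i j * z j) = (inner (v i) (u z) + e * z i) / (1 + e)" if "i < n" for i z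
  proof -
    have "(\<Sum>j<n. G i j * z j)
        = (\<Sum>j<n. (z j * inner (v i) (v j) + (if i = j then e * z i else 0)) / (1 + e))"
      by (intro sum.cong) (auto simp: G_def algebra_simps)
    then show ?thesis
      using that by (simp add: u_def inner_sum_right sum.distrib flip: sum_divide_distrib)
  qed
  have Q: "(\<Sum>i<n. z i * (\<Sum>j<n. G i j * z j))
      = ((norm (u z))\<^sup>2 + e * (\<Sum>i<n. (z i)\<^sup>2)) / (1 + e)" for z
  proof -
    have "(\<Sum>i<n. z i * (\<Sum>j<n. G i j * z j))
        = (\<Sum>i<n. (z i * inner (v i) (u z) + e * (z i)\<^sup>2) / (1 + e))"
    proof (intro sum.cong refl)
      fix i assume "i \<in> {..<n}"
      then have "i < n" by simp
      show "z i * (\<Sum>j<n. G i j * z j) = (z i * inner (v i) (u z) + e * (z i)\<^sup>2) / (1 + e)"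
        unfolding G[OF \<open>i < n\<close>] by (simp add: distrib_left power2_eq_square)
    qed
    also have "\<dots> = ((\<Sum>i<n. z i * inner (v i) (u z)) + e * (\<Sum>i<n. (z i)\<^sup>2)) / (1 + e)"
      by (simp add: sum.distrib sum_distrib_left flip: sum_divide_distrib)
    also have "(\<Sum>i<n. z i * inner (v i) (u z)) = inner (\<Sum>i<n. z i *\<^sub>R v i) (u z)"
      by (simp add: inner_sum_left)
    also have "\<dots> = (norm (u z))\<^sup>2" by (simp add: u_def power2_norm_eq_inner)
    finally show ?thesis .
  qed
  have "\<exists>y. pairing_solution n G y \<and> (\<Sum>i<n. (y i)\<^sup>2) \<le> n"
  proof (rule exists_short_solution)
    show "G i j = G j i" for i j by (simp add: G_def inner_commute)
    show "G i i = 1" if "i < n" for i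
      using unit[OF that] e by (simp add: G_def flip: power2_norm_eq_inner)
    show "0 < e / (1 + e)" using e by simp
    show "e / (1 + e) * (\<Sum>i<n. (z i)\<^sup>2) \<le> (\<Sum>i<n. z i * (\<Sum>j<n. G i j * z j))" for z
      unfolding Q using e by (simp add: divide_right_mono)
  qed
  then obtain y where y: "\<And>i. i < n \<Longrightarrow> y i * (\<Sum>j<n. G i j * y j) = 1"
    and short: "(\<Sum>i<n. (y i)\<^sup>2) \<le> n"
    unfolding pairing_solution_def by blast
  have "((norm (u y))\<^sup>2 + e * (\<Sum>i<n. (y i)\<^sup>2)) / (1 + e) = n"
    using y by (simp flip: Q)
  then have "(norm (u y))\<^sup>2 + e * (\<Sum>i<n. (y i)\<^sup>2) = (1 + e) * n"
    using e by (simp add: field_simps)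
  moreover have "y i * inner (v i) (u y) = 1 + e - e * (y i)\<^sup>2" if "i < n" for i
  proof -
    have "y i * (inner (v i) (u y) + e * y i) = 1 + e"
      using y[OF that] e unfolding G[OF that] by (simp add: divide_eq_eq)
    then show ?thesis by (simp add: algebra_simps power2_eq_square)
  qed
  ultimately show ?thesis using short by blast
qed

text \<open>The coefficient vectors of the regularized problem are bounded, hence
\<open>y\<^sub>i \<langle>v\<^sub>i, u\<rangle> \<rightarrow> 1\<close> and \<open>\<bar>u\<bar>\<^sup>2 \<rightarrow> n\<close>. Boundedness of \<open>y\<^sub>i\<close> then also forces the limit of \<open>\<langle>v\<^sub>i, u\<rangle>\<close> to be
nonzero.\<close>

lemma strong_polarization:
  fixes v :: "nat \<Rightarrow> 'a :: euclidean_space"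
  assumes unit: "\<And>i. i < n \<Longrightarrow> norm (v i) = 1"
  shows "\<exists>u. (norm u)\<^sup>2 = n \<and> (\<forall>i<n. inner (v i) u \<noteq> 0)
    \<and> (\<Sum>i<n. 1 / (inner (v i) u)\<^sup>2) \<le> n"
proof -
  define e where "e m = inverse (real (Suc m))" for m
  have epos: "0 < e m" and e1: "e m \<le> 1" for m
    by (auto simp: e_def field_simps)
  have e0: "e \<longlonglongrightarrow> 0" unfolding e_def by (rule LIMSEQ_inverse_real_of_nat)
  define P where "P m y u \<longleftrightarrow> (norm u)\<^sup>2 + e m * (\<Sum>i<n. (y i)\<^sup>2) = (1 + e m) * n
    \<and> (\<Sum>i<n. (y i)\<^sup>2) \<le> n \<and> (\<forall>i<n. y i * inner (v i) u = 1 + e m - e m * (y i)\<^sup>2)"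
    for m y u
  have "\<forall>m. \<exists>y u. P m y u"
    unfolding P_def using regularized_solution[OF unit epos] by simp
  then obtain y u where P: "\<And>m. P m (y m) (u m)"
    unfolding choice_iff by blast
  have norm_u: "(norm (u m))\<^sup>2 + e m * (\<Sum>i<n. (y m i)\<^sup>2) = (1 + e m) * n"
    and short: "(\<Sum>i<n. (y m i)\<^sup>2) \<le> n" for m
    using P[of m] unfolding P_def by auto
  have pair: "y m i * inner (v i) (u m) = 1 + e m - e m * (y m i)\<^sup>2" if "i < n" for m i
    using P[of m] that unfolding P_def by blast
  have y_bound: "(y m i)\<^sup>2 \<le> n" if "i < n" for m i
  proof -
    have "(y m i)\<^sup>2 \<le> (\<Sum>i<n. (y m i)\<^sup>2)" using that by (intro member_le_sum) auto
    with short show ?thesis by (rule order_trans[rotated])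
  qed
  have "norm (u m) \<le> sqrt (2 * n)" for m
  proof (rule real_le_rsqrt)
    have "0 \<le> e m * (\<Sum>i<n. (y m i)\<^sup>2)" using epos[of m] by (simp add: sum_nonneg)
    then have "(norm (u m))\<^sup>2 \<le> (1 + e m) * n" using norm_u[of m] by linarith
    also have "\<dots> \<le> 2 * real n" using e1[of m] by (intro mult_right_mono) auto
    finally show "(norm (u m))\<^sup>2 \<le> 2 * n" by simp
  qed
  then have "\<forall>m. u m \<in> cball 0 (sqrt (2 * n))" by simp
  moreover have "seq_compact (cball (0 :: 'a) (sqrt (2 * n)))"
    by (rule compact_imp_seq_compact[OF compact_cball])
  ultimately obtain l r where r: "strict_mono r" and lim: "(u \<circ> r) \<longlonglongrightarrow> l"
    by (meson seq_compactE)
  have lim_u: "(\<lambda>m. u (r m)) \<longlonglongrightarrow> l" using lim by (simp add: o_def)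
  have er: "(\<lambda>m. e (r m)) \<longlonglongrightarrow> 0"
    using LIMSEQ_subseq_LIMSEQ[OF e0 r] by (simp add: o_def)
  have vanish: "(\<lambda>m. e (r m) * f m) \<longlonglongrightarrow> 0" if "\<And>m. 0 \<le> f m" "\<And>m. f m \<le> n"
    for f :: "nat \<Rightarrow> real"
  proof (rule tendsto_sandwich)
    show "\<forall>\<^sub>F m in sequentially. 0 \<le> e (r m) * f m" using epos that by (simp add: less_imp_le)
    show "\<forall>\<^sub>F m in sequentially. e (r m) * f m \<le> e (r m) * n"
      using epos that by (intro always_eventually allI mult_left_mono) (auto intro: less_imp_le)
    show "(\<lambda>m. e (r m) * n) \<longlonglongrightarrow> 0" using tendsto_mult_left_zero[OF er] by simp
  qed auto
  have norm_l: "(norm l)\<^sup>2 = n"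
  proof (rule LIMSEQ_unique)
    show "(\<lambda>m. (norm (u (r m)))\<^sup>2) \<longlonglongrightarrow> (norm l)\<^sup>2" by (intro tendsto_intros lim_u)
    have "(\<lambda>m. (1 + e (r m)) * n - e (r m) * (\<Sum>i<n. (y (r m) i)\<^sup>2)) \<longlonglongrightarrow> (1 + 0) * real n - 0"
    proof (rule tendsto_diff)
      show "(\<lambda>m. (1 + e (r m)) * n) \<longlonglongrightarrow> (1 + 0) * real n" by (intro tendsto_intros er)
      show "(\<lambda>m. e (r m) * (\<Sum>i<n. (y (r m) i)\<^sup>2)) \<longlonglongrightarrow> 0"
        by (rule vanish) (simp_all add: short sum_nonneg)
    qed
    also have "(\<lambda>m. (1 + e (r m)) * n - e (r m) * (\<Sum>i<n. (y (r m) i)\<^sup>2)) = (\<lambda>m. (norm (u (r m)))\<^sup>2)"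
      unfolding norm_u[symmetric] by simp
    finally show "(\<lambda>m. (norm (u (r m)))\<^sup>2) \<longlonglongrightarrow> n" by simp
  qed
  have lim_inner: "(\<lambda>m. inner (v i) (u (r m))) \<longlonglongrightarrow> inner (v i) l" for i
    by (intro tendsto_intros lim_u)
  have lim_pair: "(\<lambda>m. y (r m) i * inner (v i) (u (r m))) \<longlonglongrightarrow> 1" if "i < n" for i
  proof -
    have "(\<lambda>m. 1 + e (r m) - e (r m) * (y (r m) i)\<^sup>2) \<longlonglongrightarrow> 1 + 0 - 0"
    proof (rule tendsto_diff)
      show "(\<lambda>m. 1 + e (r m)) \<longlonglongrightarrow> 1 + 0" by (intro tendsto_intros er)
      show "(\<lambda>m. e (r m) * (y (r m) i)\<^sup>2) \<longlonglongrightarrow> 0"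
        by (rule vanish) (simp_all add: y_bound that)
    qed
    then show ?thesis by (simp add: pair[OF that])
  qed
  have nz: "inner (v i) l \<noteq> 0" if i: "i < n" for i
  proof
    assume "inner (v i) l = 0"
    then have lim_0: "(\<lambda>m. (inner (v i) (u (r m)))\<^sup>2 * n) \<longlonglongrightarrow> 0"
      using tendsto_mult_right[OF tendsto_power[OF lim_inner[of i], of 2], of "real n"] by simp
    have lim_1: "(\<lambda>m. (y (r m) i * inner (v i) (u (r m)))\<^sup>2) \<longlonglongrightarrow> 1"
      using tendsto_power[OF lim_pair[OF i], of 2] by simp
    have "(y (r m) i * inner (v i) (u (r m)))\<^sup>2 \<le> (inner (v i) (u (r m)))\<^sup>2 * n" for m
      using mult_left_mono[OF y_bound[OF i], of "(inner (v i) (u (r m)))\<^sup>2"]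
      by (simp add: power_mult_distrib mult.commute)
    then have "(1::real) \<le> 0" using LIMSEQ_le[OF lim_1 lim_0] by blast
    then show False by simp
  qed
  have "(\<Sum>i<n. 1 / (inner (v i) l)\<^sup>2) \<le> n"
  proof (rule LIMSEQ_le_const2)
    (* q equals y, except that it is 0 where the inner product vanishes; in this form its limit
       is that of a quotient, and q^2 \<le> y^2 holds in both cases *)
    define q where "q m i = y (r m) i * inner (v i) (u (r m)) / inner (v i) (u (r m))" for m i
    have "(\<lambda>m. \<Sum>i<n. (q m i)\<^sup>2) \<longlonglongrightarrow> (\<Sum>i<n. (1 / inner (v i) l)\<^sup>2)"
    proof (intro tendsto_sum tendsto_power)
      fix i assume "i \<in> {..<n}"
      then have "i < n" by simp
      show "(\<lambda>m. q m i) \<longlonglongrightarrow> 1 / inner (v i) l"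
        unfolding q_def
        by (rule tendsto_divide[OF lim_pair[OF \<open>i < n\<close>] lim_inner nz[OF \<open>i < n\<close>]])
    qed
    then show "(\<lambda>m. \<Sum>i<n. (q m i)\<^sup>2) \<longlonglongrightarrow> (\<Sum>i<n. 1 / (inner (v i) l)\<^sup>2)"
      by (simp add: power_divide)
    have "(\<Sum>i<n. (q m i)\<^sup>2) \<le> (\<Sum>i<n. (y (r m) i)\<^sup>2)" for m
      by (intro sum_mono) (auto simp: q_def)
    then show "\<exists>N. \<forall>m\<ge>N. (\<Sum>i<n. (q m i)\<^sup>2) \<le> n" using short order_trans by blast
  qed
  with norm_l nz show ?thesis by blast
qed

theorem mainTheorem2:
  fixes n :: nat and v :: "nat \<Rightarrow> real ^ 'd"
  assumes "n \<ge> 1"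
    and "\<And>j. j \<in> {1..n} \<Longrightarrow> v j \<in> sphere 0 1"
  shows "\<exists>u \<in> sphere (0 :: real ^ 'd) 1.
           (\<forall>j \<in> {1..n}. v j \<bullet> u \<noteq> 0) \<and>
           (\<Sum>j = 1..n. 1 / (v j \<bullet> u)\<^sup>2) \<le> (real n)\<^sup>2"
proof -
  have "norm (v (Suc i)) = 1" if "i < n" for i
    using assms(2)[of "Suc i"] that by simp
  then obtain l where l: "(norm l)\<^sup>2 = n" "\<And>i. i < n \<Longrightarrow> v (Suc i) \<bullet> l \<noteq> 0"
      "(\<Sum>i<n. 1 / (v (Suc i) \<bullet> l)\<^sup>2) \<le> n"
    using strong_polarization[of n "\<lambda>i. v (Suc i)"] by blast
  define u where "u = (1 / sqrt n) *\<^sub>R l"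
  have inner_u: "v j \<bullet> u = (v j \<bullet> l) / sqrt n" for j by (simp add: u_def)
  have "norm l = sqrt n" using l(1) by (metis norm_ge_zero real_sqrt_unique)
  then have "u \<in> sphere 0 1" using assms(1) by (simp add: u_def)
  moreover have "v j \<bullet> u \<noteq> 0" if "j \<in> {1..n}" for j
  proof -
    obtain i where "j = Suc i" "i < n" using \<open>j \<in> {1..n}\<close> by (cases j) auto
    with l(2) show ?thesis by (simp add: inner_u)
  qed
  moreover have "(\<Sum>j = 1..n. 1 / (v j \<bullet> u)\<^sup>2) \<le> (real n)\<^sup>2"
  proof -
    have "(\<Sum>j = 1..n. 1 / (v j \<bullet> u)\<^sup>2) = n * (\<Sum>i<n. 1 / (v (Suc i) \<bullet> l)\<^sup>2)"
      by (simp add: sum.atLeast1_atMost_eq inner_u power_divide sum_distrib_left)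
    also have "\<dots> \<le> real n * real n" using l(3) by (intro mult_left_mono) auto
    finally show ?thesis by (simp add: power2_eq_square)
  qed
  ultimately show ?thesis by blast
qed

end
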